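(* If $\pi\in S_n$ is a permutation that is not vexillary, then neither $A_\pi$ nor $B_\pi$ is a Gröbner basis of $I_\pi$ under any diagonal term order.
   Context: Let $\mathbb k$ be a field and $\mathbb k[\mathbf z]$ the polynomial ring in the entries of the generic matrix $\mathbf z=(z_{ij})_{i,j=1}^n$; $\mathbf z_{p\times q}$ is the northwest $p\times q$ submatrix. For $\pi\in S_n$, $r^\pi_{pq}=\#\{i\le p:\pi(i)\le q\}$, $D(\pi)=\{(p,q)\in\{1,\dots,n\}^2:\pi(p)>q,\ \pi^{-1}(q)>p\}$, $\mathcal Ess(\pi)=\{(p,q)\in D(\pi):(p+1,q),(p,q+1)\notin D(\pi)\}$. $A_\pi$ is the union over $(p,q)\in\mathcal Ess(\pi)$ of the sets of minors of size $1+r^\pi_{pq}$ in $\mathbf z_{p\times q}$; $B_\pi$ is the union of the same sets over all $(p,q)$ in the $n\times n$ grid. Both generate the Schubert determinantal ideal $I_\pi$. A term order is diagonal if the leading term of every minor of $\mathbf z$ is its diagonal term. $\pi$ is vexillary if there are no $a<b<c<d$ with $\pi(b)<\pi(a)<\pi(d)<\pi(c)$. *)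

theory Defs
  imports
    "HOL-Library.Poly_Mapping"
    "HOL-Combinatorics.Permutations"
    "HOL-Algebra.Ideal"
    "Jordan_Normal_Form.Determinant"
    "Jordan_Normal_Form.DL_Submatrix"
begin

section \<open>The polynomial ring in the entries of the generic matrix\<close>

text \<open>
  A monomial is its exponent vector, and a polynomial maps monomials to coefficients.  The types
  provide a variable for every pair of natural numbers; the polynomial ring in the \<open>n * n\<close> variables
  \<open>z (i, j)\<close>, \<open>1 \<le> i, j \<le> n\<close>, is the ring record \<open>poly_ring n\<close> below.
\<close>

type_synonym monomial = "(nat \<times> nat) \<Rightarrow>\<^sub>0 nat"
type_synonym 'k polynomial = "monomial \<Rightarrow>\<^sub>0 'k"

definition z :: "nat \<times> nat \<Rightarrow> 'k::field polynomial" where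
  "z v = Poly_Mapping.single (Poly_Mapping.single v 1) 1"

definition monomials :: "nat \<Rightarrow> monomial set" where
  "monomials n = {m. Poly_Mapping.keys m \<subseteq> {1..n} \<times> {1..n}}"

definition poly_ring :: "nat \<Rightarrow> 'k::field polynomial ring" where
  "poly_ring n = \<lparr>carrier = {f. Poly_Mapping.keys f \<subseteq> monomials n},
     monoid.mult = (*), one = 1, zero = 0, add = (+)\<rparr>"

lemma monomials_add: "a \<in> monomials n \<Longrightarrow> b \<in> monomials n \<Longrightarrow> a + b \<in> monomials n"
  unfolding monomials_def using Poly_Mapping.keys_add[of a b] by blast

lemma cring_poly_ring: "cring (poly_ring n :: 'k::field polynomial ring)"
proof (rule cringI)
  let ?R = "poly_ring n :: 'k polynomial ring"
  show "abelian_group ?R"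
  proof (rule abelian_groupI)
    fix f g :: "'k polynomial"
    assume "f \<in> carrier ?R" "g \<in> carrier ?R"
    then show "f \<oplus>\<^bsub>?R\<^esub> g \<in> carrier ?R"
      using Poly_Mapping.keys_add[of f g] by (auto simp: poly_ring_def)
  next
    fix f :: "'k polynomial"
    assume "f \<in> carrier ?R"
    then show "\<exists>g\<in>carrier ?R. g \<oplus>\<^bsub>?R\<^esub> f = \<zero>\<^bsub>?R\<^esub>"
      by (intro bexI[of _ "- f"]) (auto simp: poly_ring_def in_keys_iff)
  qed (auto simp: poly_ring_def algebra_simps)
  show "Group.comm_monoid ?R"
  proof (rule comm_monoidI)
    fix f g :: "'k polynomial"
    assume "f \<in> carrier ?R" "g \<in> carrier ?R"
    then show "f \<otimes>\<^bsub>?R\<^esub> g \<in> carrier ?R"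
      using keys_mult[of f g] monomials_add by (fastforce simp: poly_ring_def)
  qed (auto simp: poly_ring_def algebra_simps monomials_def)
qed (auto simp: poly_ring_def algebra_simps)


section \<open>Term orders and Groebner bases\<close>

text \<open>\<open>(a, b) \<in> r\<close> means that \<open>a\<close> is at most \<open>b\<close>.\<close>

definition term_order :: "nat \<Rightarrow> monomial rel \<Rightarrow> bool" where
  "term_order n r \<longleftrightarrow> linear_order_on (monomials n) r
     \<and> (\<forall>m\<in>monomials n. (0, m) \<in> r)
     \<and> (\<forall>a b. \<forall>m\<in>monomials n. (a, b) \<in> r \<longrightarrow> (a + m, b + m) \<in> r)"

definition leading_monomial :: "monomial rel \<Rightarrow> 'k::field polynomial \<Rightarrow> monomial" where
  "leading_monomial r f =
     (THE m. m \<in> Poly_Mapping.keys f \<and> (\<forall>m'\<in>Poly_Mapping.keys f. (m', m) \<in> r))"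

text \<open>Only meaningful for nonzero \<open>f\<close>; the coefficient is part of the leading term.\<close>

definition leading_term :: "monomial rel \<Rightarrow> 'k::field polynomial \<Rightarrow> 'k polynomial" where
  "leading_term r f =
     Poly_Mapping.single (leading_monomial r f) (Poly_Mapping.lookup f (leading_monomial r f))"

definition initial_ideal :: "nat \<Rightarrow> monomial rel \<Rightarrow> 'k::field polynomial set \<Rightarrow> 'k polynomial set" where
  "initial_ideal n r F = Idl\<^bsub>poly_ring n\<^esub> (leading_term r ` (F - {0}))"

definition groebner_basis ::
  "nat \<Rightarrow> monomial rel \<Rightarrow> 'k::field polynomial set \<Rightarrow> 'k polynomial set \<Rightarrow> bool" where
  "groebner_basis n r G I \<longleftrightarrow> G \<subseteq> I \<and> initial_ideal n r G = initial_ideal n r I"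


section \<open>Minors of the generic matrix\<close>

text \<open>Matrices of type \<open>mat\<close> are indexed from \<open>0\<close>, the variables from \<open>1\<close>.\<close>

definition northwest :: "nat \<Rightarrow> nat \<Rightarrow> 'k::field polynomial mat" where
  "northwest p q = mat p q (\<lambda>(i, j). z (Suc i, Suc j))"

definition square_submatrices :: "nat \<Rightarrow> 'a mat \<Rightarrow> 'a mat set" where
  "square_submatrices s M =
     {submatrix M I J | I J. I \<subseteq> {..<dim_row M} \<and> J \<subseteq> {..<dim_col M} \<and> card I = s \<and> card J = s}"

definition minors :: "nat \<Rightarrow> 'a::comm_ring_1 mat \<Rightarrow> 'a set" where
  "minors s M = det ` square_submatrices s M"

text \<open>
  The type argument names the coefficient field of the minors.  Its choice does not matter, since
  the coefficients of a minor are \<open>1\<close> and \<open>- 1\<close>.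
\<close>

definition diagonal_term_order :: "'k::field itself \<Rightarrow> nat \<Rightarrow> monomial rel \<Rightarrow> bool" where
  "diagonal_term_order _ n r \<longleftrightarrow> term_order n r
     \<and> (\<forall>s. \<forall>M \<in> square_submatrices s (northwest n n :: 'k polynomial mat).
           leading_term r (det M) = prod_list (diag_mat M))"


section \<open>Schubert determinantal ideals\<close>

definition rank_fun :: "(nat \<Rightarrow> nat) \<Rightarrow> nat \<Rightarrow> nat \<Rightarrow> nat" where
  "rank_fun \<pi> p q = card {i \<in> {1..p}. \<pi> i \<le> q}"

definition diagram :: "nat \<Rightarrow> (nat \<Rightarrow> nat) \<Rightarrow> (nat \<times> nat) set" where
  "diagram n \<pi> = {(p, q). p \<in> {1..n} \<and> q \<in> {1..n} \<and> \<pi> p > q \<and> inv_into UNIV \<pi> q > p}"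

definition essential_set :: "nat \<Rightarrow> (nat \<Rightarrow> nat) \<Rightarrow> (nat \<times> nat) set" where
  "essential_set n \<pi> =
     {(p, q). (p, q) \<in> diagram n \<pi> \<and> (p + 1, q) \<notin> diagram n \<pi> \<and> (p, q + 1) \<notin> diagram n \<pi>}"

definition minors_at :: "(nat \<Rightarrow> nat) \<Rightarrow> nat \<times> nat \<Rightarrow> 'k::field polynomial set" where
  "minors_at \<pi> = (\<lambda>(p, q). minors (1 + rank_fun \<pi> p q) (northwest p q))"

definition A_minors :: "nat \<Rightarrow> (nat \<Rightarrow> nat) \<Rightarrow> 'k::field polynomial set" where
  "A_minors n \<pi> = (\<Union>v \<in> essential_set n \<pi>. minors_at \<pi> v)"

definition B_minors :: "nat \<Rightarrow> (nat \<Rightarrow> nat) \<Rightarrow> 'k::field polynomial set" where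
  "B_minors n \<pi> = (\<Union>v \<in> {1..n} \<times> {1..n}. minors_at \<pi> v)"

definition schubert_ideal :: "nat \<Rightarrow> (nat \<Rightarrow> nat) \<Rightarrow> 'k::field polynomial set" where
  "schubert_ideal n \<pi> = Idl\<^bsub>poly_ring n\<^esub> (B_minors n \<pi>)"

definition vexillary :: "nat \<Rightarrow> (nat \<Rightarrow> nat) \<Rightarrow> bool" where
  "vexillary n \<pi> \<longleftrightarrow> \<not> (\<exists>a b c d. {a, b, c, d} \<subseteq> {1..n} \<and> a < b \<and> b < c \<and> c < d
     \<and> \<pi> b < \<pi> a \<and> \<pi> a < \<pi> d \<and> \<pi> d < \<pi> c)"

end

theory Submission
  imports Defs
begin

text \<open>
  Let \<open>a < b < c < d\<close> witness that \<open>\<pi>\<close> is not vexillary, let \<open>S\<close> consist of the dots of \<open>\<pi>\<close> weakly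
  northwest of the cell \<open>(c, \<pi> d)\<close> and of this cell itself, and let \<open>f\<close> be the minor on the rows and
  columns of \<open>S\<close>.  At the indicator matrix of \<open>S\<close>, \<open>f\<close> takes the value \<open>1\<close> or \<open>- 1\<close>, and all the
  other minors in \<open>B_minors n \<pi>\<close> vanish.  The leading term of \<open>f\<close> is redundant: the dots of \<open>a\<close>
  and \<open>b\<close> form an inversion, so the condition at \<open>(a, \<pi> b)\<close> is on a leading minor of \<open>f\<close> of size
  \<open>1 + rank_fun \<pi> a (\<pi> b)\<close>, whose diagonal divides that of \<open>f\<close>.  If a subset of \<open>B_minors n \<pi>\<close>
  were a Groebner basis, \<open>f\<close> would therefore reduce to \<open>0\<close> by minors vanishing at the indicator
  matrix, and so vanish there itself.
\<close>

section \<open>Minors of the generic matrix\<close>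

text \<open>The index sets count from 0, as \<open>pick\<close> does, and the variables from 1. No
  ambient block \<open>northwest p q\<close> occurs, so minors imposed at different cells can be
  compared by their index sets alone.\<close>

definition generic_submatrix :: "nat set \<Rightarrow> nat set \<Rightarrow> 'k::field polynomial mat" where
  "generic_submatrix I J = mat (card I) (card J) (\<lambda>(i, j). z (Suc (pick I i), Suc (pick J j)))"

text \<open>The cells used by one term of the Leibniz expansion. Here \<open>p\<close> permutes
  positions, not row or column labels.\<close>

definition cells :: "nat set \<Rightarrow> nat set \<Rightarrow> (nat \<Rightarrow> nat) \<Rightarrow> (nat \<times> nat) set" where
  "cells I J p = (\<lambda>i. (Suc (pick I i), Suc (pick J (p i)))) ` {0..<card I}"

definition squarefree_monomial :: "(nat \<times> nat) set \<Rightarrow> monomial" where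
  "squarefree_monomial E = (\<Sum>v\<in>E. Poly_Mapping.single v 1)"

lemma inj_on_pick: "k \<le> card I \<Longrightarrow> inj_on (pick I) {0..<k}"
  by (rule linorder_inj_onI') (metis pick_mono_le atLeastLessThan_iff less_le_trans less_irrefl)

lemma bij_betw_pick: "finite I \<Longrightarrow> bij_betw (pick I) {0..<card I} I"
proof -
  assume fin: "finite I"
  have inj: "inj_on (pick I) {0..<card I}"
    by (rule inj_on_pick) simp
  moreover have "pick I ` {0..<card I} \<subseteq> I"
    using pick_in_set_le by auto
  ultimately show ?thesis
    using fin by (simp add: bij_betw_def card_image card_subset_eq)
qed

lemma inj_on_cell: "finite I \<Longrightarrow> inj_on (\<lambda>i. (Suc (pick I i), f i)) {0..<card I}"
  using bij_betw_pick[of I] by (auto simp: inj_on_def bij_betw_def)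

lemma dim_northwest [simp]: "dim_row (northwest p q) = p" "dim_col (northwest p q) = q"
  by (auto simp: northwest_def)

lemma submatrix_northwest:
  assumes "I \<subseteq> {..<p}" "J \<subseteq> {..<q}"
  shows "submatrix (northwest p q) I J = generic_submatrix I J"
proof -
  have *: "{i. i < p \<and> i \<in> I} = I" "{j. j < q \<and> j \<in> J} = J"
    using assms by auto
  have "pick I i < p" if "i < card I" for i
    using assms(1) pick_in_set_le[OF that] by auto
  moreover have "pick J j < q" if "j < card J" for j
    using assms(2) pick_in_set_le[OF that] by auto
  ultimately show ?thesis
    by (intro eq_matI) (auto simp: submatrix_def generic_submatrix_def northwest_def *)
qed

lemma square_submatrices_northwest:
  "square_submatrices s (northwest p q) =
     {generic_submatrix I J | I J. I \<subseteq> {..<p} \<and> J \<subseteq> {..<q} \<and> card I = s \<and> card J = s}"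
  unfolding square_submatrices_def
  by (intro Collect_cong iff_exI) (auto simp: submatrix_northwest)

lemma minors_northwest:
  "minors s (northwest p q) =
     {det (generic_submatrix I J) | I J. I \<subseteq> {..<p} \<and> J \<subseteq> {..<q} \<and> card I = s \<and> card J = s}"
  unfolding minors_def square_submatrices_northwest by blast

section \<open>Leibniz expansion of the minors\<close>

lemma prod_single:
  "(\<Prod>i\<in>A. Poly_Mapping.single (f i) (1::'k::field)) = Poly_Mapping.single (\<Sum>i\<in>A. f i :: monomial) 1"
  by (induction A rule: infinite_finite_induct) (auto simp: mult_single)

lemma prod_z:
  assumes "finite I" "finite J" "card J = card I" "\<And>i. i < card I \<Longrightarrow> p i < card I"
  shows "(\<Prod>i = 0..<card I. generic_submatrix I J $$ (i, p i)) =
    Poly_Mapping.single (squarefree_monomial (cells I J p)) (1::'k::field)"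
proof -
  have "(\<Prod>i = 0..<card I. generic_submatrix I J $$ (i, p i)) =
      (\<Prod>i = 0..<card I. Poly_Mapping.single
        (Poly_Mapping.single (Suc (pick I i), Suc (pick J (p i))) 1) (1::'k))"
    using assms by (intro prod.cong) (auto simp: generic_submatrix_def z_def)
  also have "\<dots> = Poly_Mapping.single (squarefree_monomial (cells I J p)) 1"
    unfolding prod_single squarefree_monomial_def cells_def
    using assms(1) by (simp add: sum.reindex inj_on_cell)
  finally show ?thesis .
qed

lemma det_generic_submatrix:
  assumes "finite I" "finite J" "card J = card I"
  shows "det (generic_submatrix I J) = (\<Sum>p | p permutes {0..<card I}.
    Poly_Mapping.single (squarefree_monomial (cells I J p)) (signof p :: 'k::field))"
proof -
  have *: "signof p * Poly_Mapping.single m (1::'k) = Poly_Mapping.single m (signof p)"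
    for p and m :: monomial
    by (simp add: sign_def single_uminus)
  have "det (generic_submatrix I J :: 'k polynomial mat) =
    (\<Sum>p | p permutes {0..<card I}. signof p * (\<Prod>i = 0..<card I. generic_submatrix I J $$ (i, p i)))"
    by (rule det_def') (simp add: generic_submatrix_def assms)
  also have "\<dots> = (\<Sum>p | p permutes {0..<card I}.
    Poly_Mapping.single (squarefree_monomial (cells I J p)) (signof p :: 'k::field))"
  proof (rule sum.cong[OF refl], goal_cases)
    case (1 p)
    then have "p i < card I" if "i < card I" for i
      using permutes_in_image[of p "{0..<card I}" i] that by auto
    with assms show ?case
      by (simp add: prod_z *)
  qed
  finally show ?thesis .
qed

lemma keys_squarefree_monomial: "finite E \<Longrightarrow> Poly_Mapping.keys (squarefree_monomial E) = E"
proof -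
  assume "finite E"
  then have "Poly_Mapping.lookup (squarefree_monomial E) v = (if v \<in> E then 1 else 0)" for v
    by (simp add: squarefree_monomial_def lookup_sum lookup_single when_def)
  then show ?thesis by (auto simp: in_keys_iff split: if_splits)
qed

lemma finite_cells [simp]: "finite (cells I J p)"
  by (simp add: cells_def)

lemma keys_det_generic_submatrix:
  assumes "m \<in> Poly_Mapping.keys (det (generic_submatrix I J) :: 'k::field polynomial)"
    and "finite I" "finite J" "card J = card I"
  obtains p where "p permutes {0..<card I}" "m = squarefree_monomial (cells I J p)"
proof -
  have "m \<in> (\<Union>p\<in>{p. p permutes {0..<card I}}.
      Poly_Mapping.keys (Poly_Mapping.single (squarefree_monomial (cells I J p)) (signof p :: 'k)))"
  proof (rule ccontr)
    assume "\<not> ?thesis"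
    then have "Poly_Mapping.lookup (det (generic_submatrix I J) :: 'k polynomial) m = 0"
      unfolding det_generic_submatrix[OF assms(2-4)] lookup_sum
      by (intro sum.neutral) (auto simp: in_keys_iff simp del: keys_single)
    with assms(1) show False by (simp add: in_keys_iff)
  qed
  then show ?thesis using that by (auto split: if_splits)
qed

lemma cells_subset:
  assumes "p permutes {0..<card I}" "I \<subseteq> {..<a}" "J \<subseteq> {..<b}" "card J = card I"
  shows "cells I J p \<subseteq> {1..a} \<times> {1..b}"
proof -
  have "pick I i < a" "pick J (p i) < b" if "i < card I" for i
  proof -
    show "pick I i < a" using assms(2) pick_in_set_le[OF that] by auto
    have "p i < card J" using permutes_in_image[OF assms(1), of i] that assms(4) by auto
    then show "pick J (p i) < b" using assms(3) pick_in_set_le by blast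
  qed
  then show ?thesis by (force simp: cells_def)
qed

lemma card_cells: "finite I \<Longrightarrow> card (cells I J p) = card I"
  unfolding cells_def by (simp add: card_image inj_on_cell)

lemma fst_cells: "finite I \<Longrightarrow> fst ` cells I J p = Suc ` I"
proof -
  assume "finite I"
  have "fst ` cells I J p = Suc ` pick I ` {0..<card I}"
    by (simp add: cells_def image_image)
  with bij_betw_pick[OF \<open>finite I\<close>] show ?thesis by (simp add: bij_betw_def)
qed

lemma snd_cells:
  assumes "p permutes {0..<card I}" "finite J" "card J = card I"
  shows "snd ` cells I J p = Suc ` J"
proof -
  have "snd ` cells I J p = Suc ` pick J ` p ` {0..<card I}"
    by (simp add: cells_def image_image)
  then show ?thesis
    using bij_betw_pick[of J] assms by (simp add: permutes_image bij_betw_def)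
qed


section \<open>Leading monomials\<close>

text \<open>Summing over the fixed grid rather than over the support makes additivity immediate; on
  \<open>monomials n\<close> this is the usual degree.\<close>

definition total_degree :: "nat \<Rightarrow> monomial \<Rightarrow> nat" where
  "total_degree n m = (\<Sum>v\<in>{1..n} \<times> {1..n}. Poly_Mapping.lookup m v)"

lemma total_degree_add: "total_degree n (a + b) = total_degree n a + total_degree n b"
  by (simp add: total_degree_def lookup_add sum.distrib)

lemma total_degree_squarefree_monomial:
  assumes "E \<subseteq> {1..n} \<times> {1..n}"
  shows "total_degree n (squarefree_monomial E) = card E"
proof -
  have fin: "finite E" using assms finite_subset by blast
  have "total_degree n (squarefree_monomial E) = (\<Sum>v\<in>{1..n} \<times> {1..n}. if v \<in> E then 1 else 0)"
    using fin by (simp add: total_degree_def squarefree_monomial_def lookup_sum lookup_single when_def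
      del: One_nat_def)
  also have "\<dots> = card E"
    using assms by (simp add: sum.If_cases Int_absorb1)
  finally show ?thesis .
qed

text \<open>Exponents are at most \<open>d\<close> on the grid and 0 off it, which leaves finitely
  many functions. This finiteness bounds the length of a reduction.\<close>

lemma finite_monomials_of_degree: "finite {m \<in> monomials n. total_degree n m = d}" (is "finite ?M")
proof -
  let ?A = "{1..n} \<times> {1..n}"
  let ?F = "{f :: nat \<times> nat \<Rightarrow> nat. \<forall>v. (v \<in> ?A \<longrightarrow> f v \<in> {..d}) \<and> (v \<notin> ?A \<longrightarrow> f v = 0)}"
  have "Poly_Mapping.lookup m \<in> ?F" if "m \<in> ?M" for m
  proof -
    have "Poly_Mapping.lookup m v \<le> d" if "v \<in> ?A" for v
      using member_le_sum[OF that, of "Poly_Mapping.lookup m"] \<open>m \<in> ?M\<close> by (simp add: total_degree_def)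
    moreover have "Poly_Mapping.lookup m v = 0" if "v \<notin> ?A" for v
      using that \<open>m \<in> ?M\<close> by (metis (mono_tags, lifting) mem_Collect_eq monomials_def in_keys_iff subsetD)
    ultimately show ?thesis by blast
  qed
  then have "Poly_Mapping.lookup ` ?M \<subseteq> ?F" by (rule image_subsetI)
  moreover have "finite ?F" by (rule finite_set_of_finite_funs) simp_all
  ultimately have "finite (Poly_Mapping.lookup ` ?M)" by (rule finite_subset)
  moreover have "inj_on Poly_Mapping.lookup ?M"
    by (rule inj_onI) (simp only: poly_mapping_eq_iff)
  ultimately show ?thesis by (rule finite_imageD)
qed

section \<open>Greatest monomials and initial ideals\<close>

lemma term_orderD:
  assumes "term_order n r"
  shows "r \<subseteq> monomials n \<times> monomials n" "trans r" "antisym r" "refl_on (monomials n) r"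
    "total_on (monomials n) r"
  using assms by (auto simp: term_order_def order_on_defs)

text \<open>Induction over the finite support yields a greatest monomial by totality, and
  antisymmetry makes it unique, so the definite description in \<open>leading_monomial\<close>
  denotes it.\<close>

lemma leading_monomial_greatest:
  assumes "term_order n r" "Poly_Mapping.keys f \<subseteq> monomials n" "f \<noteq> 0"
  shows "leading_monomial r f \<in> Poly_Mapping.keys f"
    and "m \<in> Poly_Mapping.keys f \<Longrightarrow> (m, leading_monomial r f) \<in> r"
proof -
  have ex: "\<exists>m\<in>K. \<forall>m'\<in>K. (m', m) \<in> r"
    if "finite K" "K \<noteq> {}" "K \<subseteq> monomials n" for K
    using that
  proof (induction K rule: finite_ne_induct)
    case (singleton x)
    then show ?case using term_orderD(4)[OF assms(1)] by (auto simp: refl_on_def)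
  next
    case (insert x K)
    then obtain m where m: "m \<in> K" "\<forall>m'\<in>K. (m', m) \<in> r" by auto
    have "m \<in> monomials n" using m(1) insert.prems by blast
    then have "(x, m) \<in> r \<or> (m, x) \<in> r" "(x, x) \<in> r"
      using insert.prems term_orderD(4,5)[OF assms(1)]
      by (cases "x = m"; auto simp: refl_on_def total_on_def)+
    then show ?case
      using m term_orderD(2)[OF assms(1)] by (auto dest: transD)
  qed
  obtain m where m: "m \<in> Poly_Mapping.keys f" "\<forall>m'\<in>Poly_Mapping.keys f. (m', m) \<in> r"
    using ex[of "Poly_Mapping.keys f"] assms(2,3) by auto
  then have "leading_monomial r f = m"
    unfolding leading_monomial_def
    using term_orderD(3)[OF assms(1)] by (intro the_equality) (auto dest: antisymD)
  with m show "leading_monomial r f \<in> Poly_Mapping.keys f"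
    "m \<in> Poly_Mapping.keys f \<Longrightarrow> (m, leading_monomial r f) \<in> r" for m
    by auto
qed

text \<open>The polynomials all of whose monomials are divisible by the leading monomial of some
  nonzero element of \<open>G\<close> form an ideal. It contains the generators of the initial
  ideal, hence all of it.\<close>

lemma initial_ideal_keyE:
  fixes G :: "'k::field polynomial set"
  assumes ord: "term_order n r" and G: "G \<subseteq> carrier (poly_ring n)"
    and m: "m \<in> Poly_Mapping.keys f" and f: "f \<in> initial_ideal n r G"
  obtains g t where "g \<in> G" "g \<noteq> 0" "t \<in> monomials n" "m = t + leading_monomial r g"
proof -
  let ?R = "poly_ring n :: 'k polynomial ring"
  interpret R: cring ?R by (rule cring_poly_ring)
  define K where "K = {f \<in> carrier ?R. \<forall>m\<in>Poly_Mapping.keys f.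
    \<exists>g\<in>G - {0}. \<exists>t\<in>monomials n. m = t + leading_monomial r g}"
  have uminus: "\<ominus>\<^bsub>?R\<^esub> f = - f" if "f \<in> carrier ?R" for f
    using that by (intro R.minus_equality) (auto simp: poly_ring_def in_keys_iff)
  have "ideal K ?R"
  proof (rule idealI)
    show "ring ?R" by (rule R.ring_axioms)
    show "subgroup K (add_monoid ?R)"
    proof (rule R.add.subgroupI)
      show "K \<subseteq> carrier ?R" by (auto simp: K_def)
      show "K \<noteq> {}" by (auto simp: K_def poly_ring_def intro!: exI[of _ 0])
      show "\<ominus>\<^bsub>?R\<^esub> a \<in> K" if "a \<in> K" for a
        using that uminus[of a] by (auto simp: K_def poly_ring_def in_keys_iff)
      show "a \<oplus>\<^bsub>?R\<^esub> b \<in> K" if "a \<in> K" "b \<in> K" for a b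
      proof -
        have "a \<oplus>\<^bsub>?R\<^esub> b \<in> carrier ?R" using that by (simp add: K_def)
        moreover have "Poly_Mapping.keys (a \<oplus>\<^bsub>?R\<^esub> b) \<subseteq> Poly_Mapping.keys a \<union> Poly_Mapping.keys b"
          by (simp add: poly_ring_def Poly_Mapping.keys_add)
        ultimately show ?thesis using that unfolding K_def by blast
      qed
    qed
    show times: "x \<otimes>\<^bsub>?R\<^esub> a \<in> K" if "a \<in> K" "x \<in> carrier ?R" for a x
    proof -
      have "\<exists>g\<in>G - {0}. \<exists>t\<in>monomials n. m = t + leading_monomial r g"
        if "m \<in> Poly_Mapping.keys (x * a)" for m
      proof -
        from that keys_mult[of x a] obtain u v
          where uv: "m = u + v" "u \<in> Poly_Mapping.keys x" "v \<in> Poly_Mapping.keys a"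
          by auto
        then obtain g t where g: "g \<in> G - {0}" "t \<in> monomials n" "v = t + leading_monomial r g"
          using \<open>a \<in> K\<close> unfolding K_def by blast
        moreover have "u + t \<in> monomials n"
          using uv(2) g(2) \<open>x \<in> carrier ?R\<close> by (auto simp: poly_ring_def intro: monomials_add)
        ultimately show ?thesis
          using uv(1) by (metis add.assoc)
      qed
      moreover have "x \<otimes>\<^bsub>?R\<^esub> a \<in> carrier ?R"
        using that by (auto simp: K_def)
      ultimately show ?thesis by (auto simp: K_def poly_ring_def)
    qed
    show "a \<otimes>\<^bsub>?R\<^esub> x \<in> K" if "a \<in> K" "x \<in> carrier ?R" for a x
      using times[OF that] that R.m_comm[of a x] by (auto simp: K_def)
  qed
  moreover have "leading_term r ` (G - {0}) \<subseteq> K"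
  proof
    fix u assume "u \<in> leading_term r ` (G - {0})"
    then obtain g where g: "g \<in> G" "g \<noteq> 0" "u = leading_term r g" by auto
    then have lm: "leading_monomial r g \<in> monomials n"
      using leading_monomial_greatest(1)[OF ord, of g] G by (auto simp: poly_ring_def)
    have "0 \<in> monomials n" by (simp add: monomials_def)
    then have "\<exists>g'\<in>G - {0}. \<exists>t\<in>monomials n. leading_monomial r g = t + leading_monomial r g'"
      using g(1,2) by (intro bexI[of _ g] bexI[of _ 0]) auto
    with lm show "u \<in> K"
      by (simp add: K_def poly_ring_def leading_term_def g(3))
  qed
  ultimately have "initial_ideal n r G \<subseteq> K"
    unfolding initial_ideal_def by (rule R.genideal_minimal)
  with f m that show ?thesis unfolding K_def by blast
qed


section \<open>Evaluation at the indicator matrix of a set of cells\<close>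

text \<open>At the 0-1 matrix supported on \<open>S\<close>, a monomial has the value 1 if all its
  variables lie in \<open>S\<close>, and 0 otherwise, whatever its exponents.\<close>

definition eval_at :: "(nat \<times> nat) set \<Rightarrow> 'k::field polynomial \<Rightarrow> 'k" where
  "eval_at S f = (\<Sum>m \<in> Poly_Mapping.keys f. if Poly_Mapping.keys m \<subseteq> S then Poly_Mapping.lookup f m else 0)"

text \<open>Terms may cancel in \<open>f + g\<close>, so its support differs from those of
  \<open>f\<close> and \<open>g\<close>. Over a common superset the values add up termwise.\<close>

lemma eval_at_superset:
  assumes "finite A" "Poly_Mapping.keys f \<subseteq> A"
  shows "eval_at S f = (\<Sum>m\<in>A. if Poly_Mapping.keys m \<subseteq> S then Poly_Mapping.lookup f m else 0)"
  unfolding eval_at_def using assms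
  by (intro sum.mono_neutral_left) (auto simp: in_keys_iff)

lemma eval_at_0 [simp]: "eval_at S 0 = 0"
  by (simp add: eval_at_def)

lemma eval_at_add: "eval_at S (f + g) = eval_at S f + eval_at S g"
proof -
  let ?A = "Poly_Mapping.keys f \<union> Poly_Mapping.keys g"
  have "eval_at S h = (\<Sum>m\<in>?A. if Poly_Mapping.keys m \<subseteq> S then Poly_Mapping.lookup h m else 0)"
    if "h \<in> {f, g, f + g}" for h
    using that Poly_Mapping.keys_add[of f g] by (intro eval_at_superset) auto
  then show ?thesis
    by (auto simp: lookup_add sum.distrib[symmetric] intro!: sum.cong)
qed

lemma eval_at_diff: "eval_at S (f - g) = eval_at S f - eval_at S g"
  using eval_at_add[of S "f - g" g] by simp

lemma eval_at_sum: "eval_at S (\<Sum>i\<in>A. f i) = (\<Sum>i\<in>A. eval_at S (f i))"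
  by (induction A rule: infinite_finite_induct) (auto simp: eval_at_add)

lemma eval_at_single:
  "eval_at S (Poly_Mapping.single m c) = (if Poly_Mapping.keys m \<subseteq> S then c else 0)"
  by (simp add: eval_at_def)

lemma keys_monomial_add: "Poly_Mapping.keys (a + b :: monomial) = Poly_Mapping.keys a \<union> Poly_Mapping.keys b"
  by (auto simp: in_keys_iff lookup_add)

lemma polynomial_eq_sum_single:
  "f = (\<Sum>m\<in>Poly_Mapping.keys f. Poly_Mapping.single m (Poly_Mapping.lookup f m))"
  by (rule poly_mapping_eqI) (auto simp: lookup_sum lookup_single when_def in_keys_iff)

lemma single_mult_eq_sum:
  "Poly_Mapping.single t c * f =
    (\<Sum>m\<in>Poly_Mapping.keys f. Poly_Mapping.single (t + m) (c * Poly_Mapping.lookup f m))"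
  for f :: "'k::field polynomial"
  by (subst polynomial_eq_sum_single) (simp add: sum_distrib_left mult_single)

text \<open>Multiplicativity for a factor that is a single term, as in a reduction step: a product
  of monomials has its variables in \<open>S\<close> iff both factors do.\<close>

lemma eval_at_single_mult:
  "eval_at S (Poly_Mapping.single t c * f) = (if Poly_Mapping.keys t \<subseteq> S then c else 0) * eval_at S f"
proof -
  have "eval_at S (Poly_Mapping.single t c * f) = (\<Sum>m\<in>Poly_Mapping.keys f.
      if Poly_Mapping.keys (t + m) \<subseteq> S then c * Poly_Mapping.lookup f m else 0)"
    by (simp add: single_mult_eq_sum eval_at_sum eval_at_single)
  then show ?thesis
    by (auto simp: eval_at_def keys_monomial_add sum_distrib_left intro!: sum.cong)
qed

section \<open>Values of minors at supports of permutations\<close>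

lemma eval_at_det:
  assumes "finite I" "finite J" "card J = card I"
  shows "eval_at S (det (generic_submatrix I J)) = (\<Sum>p | p permutes {0..<card I}.
    if cells I J p \<subseteq> S then (signof p :: 'k::field) else 0)"
  by (simp add: det_generic_submatrix[OF assms] eval_at_sum eval_at_single keys_squarefree_monomial)

text \<open>Both sets are graphs of functions on the same rows, and \<open>pick\<close> is
  injective, so inclusion already forces equality.\<close>

lemma cells_subset_cellsD:
  assumes "finite I" "finite J" "card J = card I"
    and p: "p permutes {0..<card I}" and q: "q permutes {0..<card I}"
    and sub: "cells I J p \<subseteq> cells I J q"
  shows "p = q"
proof
  fix i
  show "p i = q i"
  proof (cases "i < card I")
    case True
    then obtain i' where i': "i' < card I" "pick I i = pick I i'" "pick J (p i) = pick J (q i')"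
      using sub by (force simp: cells_def)
    with True have "i = i'"
      using bij_betw_pick[OF assms(1)] by (auto simp: bij_betw_def dest: inj_onD)
    moreover have "p i \<in> {0..<card J}" "q i \<in> {0..<card J}"
      using True permutes_in_image[OF p, of i] permutes_in_image[OF q, of i] assms(3) by auto
    ultimately show ?thesis
      using i'(3) bij_betw_pick[OF assms(2)] by (auto simp: bij_betw_def dest: inj_onD)
  next
    case False
    then show ?thesis using p q by (simp add: permutes_def)
  qed
qed

text \<open>On the cells of \<open>p\<close> only the term of \<open>p\<close> survives, and its
  sign is nonzero in every field.\<close>

lemma eval_at_cells_neq_0:
  assumes "finite I" "finite J" "card J = card I" "p permutes {0..<card I}"
  shows "eval_at (cells I J p) (det (generic_submatrix I J)) \<noteq> (0 :: 'k::field)"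
proof -
  have "eval_at (cells I J p) (det (generic_submatrix I J)) =
      (\<Sum>q | q permutes {0..<card I}. if q = p then (signof p :: 'k) else 0)"
    unfolding eval_at_det[OF assms(1-3)]
    using cells_subset_cellsD[OF assms(1-3) _ assms(4)] by (intro sum.cong) auto
  then show ?thesis
    using assms(4) by (simp add: finite_permutations sign_def)
qed

text \<open>Turns a bijection of labels into a permutation of positions, the form in which the terms
  of a determinant are indexed.\<close>

lemma graph_eq_cells:
  assumes "finite I" "finite J" and bij: "bij_betw \<tau> (Suc ` I) (Suc ` J)"
  obtains p where "p permutes {0..<card I}" "cells I J p = (\<lambda>x. (x, \<tau> x)) ` Suc ` I"
proof -
  have card: "card J = card I"
    using bij_betw_same_card[OF bij] by (simp add: card_image)
  \<comment> \<open>From a position to a row index, to its label, through \<open>\<tau>\<close> to a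
    column label, to its index, and back to a position.\<close>
  define f where "f = inv_into {0..<card J} (pick J) \<circ> (\<lambda>y. y - 1) \<circ> \<tau> \<circ> Suc \<circ> pick I"
  have b1: "bij_betw (pick I) {0..<card I} I" by (rule bij_betw_pick[OF assms(1)])
  have b2: "bij_betw Suc I (Suc ` I)" by (simp add: bij_betw_def)
  have b3: "bij_betw (\<lambda>y. y - 1) (Suc ` J) J"
    by (auto simp: bij_betw_def inj_on_def image_image)
  have bJ: "bij_betw (pick J) {0..<card J} J" by (rule bij_betw_pick[OF assms(2)])
  have "bij_betw f {0..<card I} {0..<card J}"
    unfolding f_def
    by (intro bij_betw_trans[OF b1] bij_betw_trans[OF b2] bij_betw_trans[OF bij]
      bij_betw_trans[OF b3] bij_betw_inv_into[OF bJ])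
  \<comment> \<open>Off the positions \<open>p\<close> is the identity, as \<open>permutes\<close>
    requires.\<close>
  moreover define p where "p i = (if i < card I then f i else i)" for i
  ultimately have "bij_betw p {0..<card I} {0..<card I}"
    using card by (subst bij_betw_cong[of _ p f]) (auto simp: p_def)
  then have "p permutes {0..<card I}"
    by (rule bij_imp_permutes) (simp add: p_def)
  moreover have "Suc (pick J (p i)) = \<tau> (Suc (pick I i))" if i: "i < card I" for i
  proof -
    have "pick I i \<in> I" using pick_in_set_le[OF i] .
    then obtain y where y: "y \<in> J" "\<tau> (Suc (pick I i)) = Suc y"
      using bij by (auto simp: bij_betw_def)
    then have "f i = inv_into {0..<card J} (pick J) y"
      by (simp add: f_def)
    then show ?thesis
      using y bJ i by (simp add: p_def bij_betw_inv_into_right)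
  qed
  then have "cells I J p = (\<lambda>x. (x, \<tau> x)) ` Suc ` pick I ` {0..<card I}"
    by (auto simp: cells_def image_image)
  ultimately show ?thesis
    using that b1 by (auto simp: bij_betw_def)
qed

section \<open>Reduction of homogeneous polynomials\<close>

definition homogeneous :: "nat \<Rightarrow> nat \<Rightarrow> 'k::field polynomial \<Rightarrow> bool" where
  "homogeneous n d f \<longleftrightarrow> (\<forall>m\<in>Poly_Mapping.keys f. total_degree n m = d)"

text \<open>
  Reducing a homogeneous polynomial by the polynomials \<open>g'\<close> keeps its degree and its value, and there
  are only finitely many monomials of that degree.  So the reduction ends at \<open>0\<close>, without an appeal
  to Dickson's lemma.
\<close>

lemma eval_at_ideal_eq_0:
  fixes G I :: "'k::field polynomial set"
  assumes ord: "term_order n r" and I: "ideal I (poly_ring n)"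
    and gb: "groebner_basis n r G I"
    and red: "\<And>g. g \<in> G \<Longrightarrow> g \<noteq> 0 \<Longrightarrow> \<exists>g'\<in>I. \<exists>t\<in>monomials n. g' \<noteq> 0
      \<and> leading_monomial r g = t + leading_monomial r g' \<and> eval_at S g' = 0 \<and> (\<exists>d. homogeneous n d g')"
    and "f \<in> I" "homogeneous n d f"
  shows "eval_at S f = 0"
proof -
  let ?R = "poly_ring n :: 'k polynomial ring"
  interpret R: cring ?R by (rule cring_poly_ring)
  interpret ideal I ?R by (rule I)
  have I_sub: "I \<subseteq> carrier ?R" using Icarr by blast
  have keysI: "Poly_Mapping.keys f \<subseteq> monomials n" if "f \<in> I" for f
    using I_sub that by (auto simp: poly_ring_def)
  note lm = leading_monomial_greatest[OF ord keysI]
  \<comment> \<open>The termination measure: the number of monomials of the fixed degree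
    \<open>d\<close> weakly below the leading monomial.\<close>
  define \<mu> where "\<mu> f = card {m \<in> monomials n. total_degree n m = d \<and> (m, leading_monomial r f) \<in> r}"
    for f :: "'k polynomial"
  show ?thesis
    using assms(5,6)
  proof (induction "\<mu> f" arbitrary: f rule: less_induct)
    case less
    show ?case
    proof (cases "f = 0")
      case False
      let ?m = "leading_monomial r f"
      have m: "?m \<in> Poly_Mapping.keys f" by (rule lm(1)[OF less.prems(1) False])
      have "G \<subseteq> I" using gb by (simp add: groebner_basis_def)
      have "leading_term r f \<in> initial_ideal n r I"
        unfolding initial_ideal_def
      proof (rule subsetD[OF R.genideal_self])
        show "leading_term r ` (I - {0}) \<subseteq> carrier ?R"
        proof
          fix u assume "u \<in> leading_term r ` (I - {0})"
          then obtain g where "g \<in> I" "g \<noteq> 0" "u = leading_term r g" by auto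
          then show "u \<in> carrier ?R"
            using lm(1)[of g] keysI[of g] by (auto simp: poly_ring_def leading_term_def)
        qed
        show "leading_term r f \<in> leading_term r ` (I - {0})"
          using less.prems(1) False by blast
      qed
      then have "leading_term r f \<in> initial_ideal n r G"
        using gb by (simp add: groebner_basis_def)
      moreover have "?m \<in> Poly_Mapping.keys (leading_term r f)"
        using m by (simp add: leading_term_def in_keys_iff)
      moreover have "G \<subseteq> carrier ?R" using \<open>G \<subseteq> I\<close> I_sub by blast
      ultimately obtain g t1 where g: "g \<in> G" "g \<noteq> 0" "t1 \<in> monomials n"
        "?m = t1 + leading_monomial r g"
        using initial_ideal_keyE[OF ord] by metis
      \<comment> \<open>The divisor \<open>g\<close> is exchanged for \<open>g'\<close>, which has
        the value 0 and whose leading monomial divides that of \<open>g\<close>, hence that of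
        \<open>f\<close>.\<close>
      from red[OF g(1,2)] obtain g' t2 e where g': "g' \<in> I" "g' \<noteq> 0" "t2 \<in> monomials n"
        "leading_monomial r g = t2 + leading_monomial r g'" "eval_at S g' = 0" "homogeneous n e g'"
        by blast
      define t where "t = t1 + t2"
      have t: "t \<in> monomials n" "?m = t + leading_monomial r g'"
        using g g' by (auto simp: t_def monomials_add add.assoc)
      let ?m' = "leading_monomial r g'"
      have m': "?m' \<in> Poly_Mapping.keys g'" by (rule lm(1)[OF g'(1,2)])
      \<comment> \<open>The quotient of the leading coefficients, so that the subtraction cancels
        the leading monomial of \<open>f\<close>.\<close>
      define c where "c = Poly_Mapping.lookup f ?m / Poly_Mapping.lookup g' ?m'"
      define h where "h = f - Poly_Mapping.single t c * g'"
      have lookup_mult_single: "Poly_Mapping.lookup (Poly_Mapping.single t c * g') (t + u)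
        = c * Poly_Mapping.lookup g' u" for u
        by (auto simp: single_mult_eq_sum lookup_sum lookup_single when_def in_keys_iff)
      have keys_h: "v \<in> Poly_Mapping.keys f \<or> (\<exists>u\<in>Poly_Mapping.keys g'. v = t + u)"
        if "v \<in> Poly_Mapping.keys h" for v
        using that keys_diff[of f "Poly_Mapping.single t c * g'"]
          keys_mult[of "Poly_Mapping.single t c" g']
        by (auto simp: h_def split: if_splits)
      have "total_degree n ?m = d" "total_degree n ?m' = e"
        using less.prems(2) m g'(6) m' by (auto simp: homogeneous_def)
      \<comment> \<open>The degree of \<open>t\<close> makes up the difference between
        \<open>e\<close> and \<open>d\<close>, so every monomial of the subtracted multiple has
        degree \<open>d\<close>.\<close>
      then have "homogeneous n d h"
        using keys_h less.prems(2) g'(6) t(2)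
        by (auto simp: homogeneous_def total_degree_add dest!: keys_h)
      moreover have "h \<in> I"
      proof -
        have "Poly_Mapping.single t (- c) \<in> carrier ?R"
          using t(1) by (auto simp: poly_ring_def)
        then have "f \<oplus>\<^bsub>?R\<^esub> (Poly_Mapping.single t (- c) \<otimes>\<^bsub>?R\<^esub> g') \<in> I"
          using less.prems(1) g'(1) by (intro a_closed I_l_closed)
        then show ?thesis by (simp add: poly_ring_def h_def single_uminus)
      qed
      moreover have "eval_at S h = eval_at S f"
        by (simp add: h_def eval_at_diff eval_at_single_mult g'(5))
      \<comment> \<open>For \<open>h = 0\<close> the leading monomial is an unspecified value and
        the measure says nothing; in that case \<open>eval_at S h = 0\<close> holds
        outright.\<close>
      moreover have "\<mu> h < \<mu> f \<or> h = 0"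
      proof (rule disjCI)
        assume "h \<noteq> 0"
        let ?l = "leading_monomial r h"
        have l: "?l \<in> Poly_Mapping.keys h" by (rule lm(1)[OF \<open>h \<in> I\<close> \<open>h \<noteq> 0\<close>])
        have "Poly_Mapping.lookup h ?m = 0"
          using m' by (simp add: h_def lookup_minus lookup_mult_single t(2)) (simp add: c_def t(2) in_keys_iff)
        with l have "?l \<noteq> ?m" by (auto simp: in_keys_iff)
        have le: "(?l, ?m) \<in> r"
          using keys_h[OF l]
        proof
          assume "?l \<in> Poly_Mapping.keys f"
          then show ?thesis by (rule lm(2)[OF less.prems(1) False])
        next
          assume "\<exists>u\<in>Poly_Mapping.keys g'. ?l = t + u"
          then obtain u where u: "u \<in> Poly_Mapping.keys g'" "?l = u + t"
            by (auto simp: add.commute)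
          have "(u, ?m') \<in> r" by (rule lm(2)[OF g'(1,2) u(1)])
          then have "(u + t, ?m' + t) \<in> r"
            using ord t(1) by (auto simp: term_order_def)
          then show ?thesis by (simp add: u(2) t(2) add.commute)
        qed
        have "?m \<in> monomials n" using m keysI[OF less.prems(1)] by blast
        then have "(?m, ?m) \<in> r"
          using term_orderD(4)[OF ord] by (auto simp: refl_on_def)
        \<comment> \<open>The leading monomial of \<open>f\<close> is counted for \<open>f\<close>
          but not for \<open>h\<close>, so the measure drops strictly.\<close>
        moreover have "(?m, ?l) \<notin> r"
          using le \<open>?l \<noteq> ?m\<close> term_orderD(3)[OF ord] by (auto dest: antisymD)
        moreover have "{v \<in> monomials n. total_degree n v = d \<and> (v, ?l) \<in> r} \<subseteq>
            {v \<in> monomials n. total_degree n v = d \<and> (v, ?m) \<in> r}"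
          using le term_orderD(2)[OF ord] by (auto dest: transD)
        ultimately have "{v \<in> monomials n. total_degree n v = d \<and> (v, ?l) \<in> r} \<subset>
            {v \<in> monomials n. total_degree n v = d \<and> (v, ?m) \<in> r}"
          using \<open>?m \<in> monomials n\<close> \<open>total_degree n ?m = d\<close> by blast
        moreover have "finite {v \<in> monomials n. total_degree n v = d \<and> (v, ?m) \<in> r}"
          by (rule finite_subset[OF _ finite_monomials_of_degree[of n d]]) auto
        ultimately show "\<mu> h < \<mu> f"
          unfolding \<mu>_def by (intro psubset_card_mono)
      qed
      ultimately show ?thesis
        using less.hyps[of h] by auto
    qed simp
  qed
qed

section \<open>The Schubert determinantal ideal of a permutation that is not vexillary\<close>

lemma det_generic_submatrix_in_carrier:
  assumes "I \<subseteq> {..<n}" "J \<subseteq> {..<n}" "card J = card I"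
  shows "det (generic_submatrix I J) \<in> carrier (poly_ring n)"
proof -
  have fin: "finite I" "finite J" using assms(1,2) finite_subset by auto
  have "m \<in> monomials n"
    if m: "m \<in> Poly_Mapping.keys (det (generic_submatrix I J) :: 'a polynomial)" for m
  proof -
    obtain p where p: "p permutes {0..<card I}" "m = squarefree_monomial (cells I J p)"
      by (rule keys_det_generic_submatrix[OF m fin assms(3)])
    then show ?thesis
      using cells_subset[OF p(1) assms] by (simp add: monomials_def keys_squarefree_monomial)
  qed
  then show ?thesis by (auto simp: poly_ring_def)
qed

lemma homogeneous_det:
  assumes "I \<subseteq> {..<n}" "J \<subseteq> {..<n}" "card J = card I"
  shows "homogeneous n (card I) (det (generic_submatrix I J))"
  unfolding homogeneous_def
proof
  fix m assume m: "m \<in> Poly_Mapping.keys (det (generic_submatrix I J) :: 'a polynomial)"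
  have fin: "finite I" "finite J" using assms(1,2) finite_subset by auto
  obtain p where p: "p permutes {0..<card I}" "m = squarefree_monomial (cells I J p)"
    by (rule keys_det_generic_submatrix[OF m fin assms(3)])
  then show "total_degree n m = card I"
    using total_degree_squarefree_monomial[OF cells_subset[OF p(1) assms]] card_cells[OF fin(1)] by simp
qed

text \<open>A diagonal order prescribes the leading term. This is a single term, and its coefficient
  at the diagonal monomial is 1, so it can only be supported there.\<close>

lemma leading_monomial_det:
  assumes "diagonal_term_order TYPE('k::field) n r"
    and "I \<subseteq> {..<n}" "J \<subseteq> {..<n}" "card J = card I"
  shows "leading_monomial r (det (generic_submatrix I J) :: 'k polynomial) = squarefree_monomial (cells I J id)"
proof -
  let ?M = "generic_submatrix I J :: 'k polynomial mat"
  have fin: "finite I" "finite J" using assms(2,3) finite_subset by auto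
  have "?M \<in> square_submatrices (card I) (northwest n n)"
    using assms unfolding square_submatrices_northwest by blast
  then have "leading_term r (det ?M) = prod_list (diag_mat ?M)"
    using assms(1) by (auto simp: diagonal_term_order_def)
  also have "\<dots> = (\<Prod>i = 0..<card I. ?M $$ (i, id i))"
    by (simp add: prod_list_diag_prod generic_submatrix_def)
  also have "\<dots> = Poly_Mapping.single (squarefree_monomial (cells I J id)) 1"
    by (rule prod_z[OF fin assms(4)]) simp
  finally have "Poly_Mapping.lookup (leading_term r (det ?M)) (squarefree_monomial (cells I J id)) = 1"
    by simp
  then show ?thesis
    by (auto simp: leading_term_def lookup_single when_def split: if_splits)
qed

text \<open>Among the first \<open>k\<close> elements of \<open>I\<close>, exactly \<open>i\<close>
  precede \<open>pick I i\<close>. Hence the diagonal of a minor on initial segments of the rows and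
  columns is an initial segment of the larger diagonal.\<close>

lemma pick_image:
  assumes "k \<le> card I" "i < k"
  shows "pick (pick I ` {0..<k}) i = pick I i"
proof -
  let ?K = "pick I ` {0..<k}"
  have mono: "pick I j < pick I i \<longleftrightarrow> j < i" if "j < card I" "i < card I" for i j
    using pick_mono_le[OF that(1), of i] pick_mono_le[OF that(2), of j] by (cases i j rule: linorder_cases) auto
  have "{x \<in> ?K. x < pick I i} = pick I ` {0..<i}"
    using assms mono[of _ i] by auto
  moreover have "inj_on (pick I) {0..<i}"
    using assms by (intro inj_on_pick) simp
  ultimately have "card {x \<in> ?K. x < pick I i} = i"
    by (simp add: card_image)
  with pick_card_in_set[of "pick I i" ?K] assms(2) show ?thesis
    by simp
qed

lemma card_pick_image: "k \<le> card I \<Longrightarrow> card (pick I ` {0..<k}) = k"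
  by (simp add: card_image inj_on_pick)

text \<open>The first \<open>k\<close> elements are the smallest ones. This places a leading minor
  inside the northwest block of a condition.\<close>

lemma pick_image_subset:
  assumes "k \<le> card {x \<in> I. x < a}"
  shows "pick I ` {0..<k} \<subseteq> {..<a}"
proof -
  have "{x. x < a \<and> x \<in> I} = {x \<in> I. x < a}" by blast
  then show ?thesis using assms pick_le[of _ a I] by force
qed

lemma squarefree_monomial_Un_disjoint:
  assumes "finite A" "finite B" "A \<inter> B = {}"
  shows "squarefree_monomial (A \<union> B) = squarefree_monomial A + squarefree_monomial B"
  using assms
  by (simp add: squarefree_monomial_def sum.union_disjoint)

text \<open>
  A nonzero term of the minor at \<open>(p, q)\<close> uses \<open>1 + rank_fun \<pi> p q\<close> cells of \<open>S\<close>, at most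
  \<open>rank_fun \<pi> p q\<close> of which are dots of \<open>\<pi>\<close>.  So it uses \<open>(c, v)\<close>, and then monotonicity of the
  rank function leaves no cell of \<open>S\<close> out.
\<close>

lemma eval_at_minor_neq_0D:
  fixes \<pi> :: "nat \<Rightarrow> nat"
  assumes IJ: "I \<subseteq> {..<p}" "J \<subseteq> {..<q}" "card I = 1 + rank_fun \<pi> p q" "card J = card I"
    and S: "S = insert (c, v) ((\<lambda>x. (x, \<pi> x)) ` {x \<in> {1..c}. \<pi> x \<le> v})" and c: "\<pi> c > v"
    and nz: "eval_at S (det (generic_submatrix I J) :: 'k::field polynomial) \<noteq> 0"
  shows "Suc ` I = fst ` S \<and> Suc ` J = snd ` S"
proof -
  have fin: "finite I" "finite J" using IJ(1,2) finite_subset by auto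
  from nz obtain w where w: "w permutes {0..<card I}" "cells I J w \<subseteq> S"
    unfolding eval_at_det[OF fin IJ(4)] by (auto elim!: sum.not_neutral_contains_not_neutral split: if_splits)
  let ?E = "cells I J w"
  have box: "?E \<subseteq> {1..p} \<times> {1..q}" by (rule cells_subset[OF w(1) IJ(1,2,4)])
  have card_E: "card ?E = 1 + rank_fun \<pi> p q" using card_cells[OF fin(1)] IJ(3) by simp
  let ?D = "\<lambda>c v. (\<lambda>x. (x, \<pi> x)) ` {x \<in> {1..c}. \<pi> x \<le> v}"
  have card_D: "card (?D c v) = rank_fun \<pi> c v" for c v
    by (simp add: card_image inj_on_def rank_fun_def)
  have sub: "?E - {(c, v)} \<subseteq> ?D p q"
  proof
    fix e assume e: "e \<in> ?E - {(c, v)}"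
    then have "e \<in> S" "e \<in> {1..p} \<times> {1..q}" using w(2) box by blast+
    with e show "e \<in> ?D p q" unfolding S by auto
  qed
  have "(c, v) \<in> ?E"
  proof (rule ccontr)
    assume "(c, v) \<notin> ?E"
    then have "card ?E \<le> card (?D p q)" using sub by (intro card_mono) auto
    then show False using card_E card_D[of p q] by simp
  qed
  \<comment> \<open>That \<open>(c, v)\<close> lies in the box means \<open>c \<le> p\<close> and
    \<open>v \<le> q\<close>.\<close>
  then have "?D c v \<subseteq> ?D p q" using box by auto
  then have "rank_fun \<pi> c v \<le> rank_fun \<pi> p q"
    using card_mono[of "?D p q" "?D c v"] card_D by simp
  \<comment> \<open>Since \<open>\<pi> c > v\<close>, the cell \<open>(c, v)\<close> is not a dot of
    \<open>\<pi>\<close> and adds one to the count.\<close>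
  moreover have "card S = 1 + rank_fun \<pi> c v"
    using c card_D[of c v] unfolding S by (subst card_insert_disjoint) auto
  moreover have "finite S" unfolding S by simp
  ultimately have "?E = S" using w(2) card_E card_mono[of S ?E] by (intro card_seteq) auto
  then show ?thesis
    using fst_cells[OF fin(1), of J w] snd_cells[OF w(1) fin(2) IJ(4)] by simp
qed

text \<open>An arbitrary \<open>G\<close> inside \<open>B_minors n \<pi>\<close> covers both
  generating sets at once.\<close>

lemma not_groebner_basis:
  fixes \<pi> :: "nat \<Rightarrow> nat" and G :: "'k::field polynomial set"
  assumes perm: "\<pi> permutes {1..n}"
    and abcd: "{a, b, c, d} \<subseteq> {1..n}" "a < b" "b < c" "c < d" "\<pi> b < \<pi> a" "\<pi> a < \<pi> d" "\<pi> d < \<pi> c"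
    and ord: "diagonal_term_order TYPE('k) n r"
    and G: "G \<subseteq> B_minors n \<pi>"
  shows "\<not> groebner_basis n r G (schubert_ideal n \<pi>)"
proof
  assume gb: "groebner_basis n r G (schubert_ideal n \<pi>)"
  let ?R = "poly_ring n :: 'k polynomial ring"
  interpret R: cring ?R by (rule cring_poly_ring)
  have torder: "term_order n r" using ord by (simp add: diagonal_term_order_def)
  have inj: "inj \<pi>" using perm by (rule permutes_inj)
  have pi_in: "\<pi> x \<in> {1..n}" if "x \<in> {1..n}" for x
    using permutes_in_image[OF perm] that by blast
  have B_iff: "f \<in> B_minors n \<pi> \<longleftrightarrow> (\<exists>p\<in>{1..n}. \<exists>q\<in>{1..n}. \<exists>I J. f = det (generic_submatrix I J)
      \<and> I \<subseteq> {..<p} \<and> J \<subseteq> {..<q} \<and> card I = 1 + rank_fun \<pi> p q \<and> card J = 1 + rank_fun \<pi> p q)"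
    for f :: "'k polynomial"
    unfolding B_minors_def minors_at_def minors_northwest by auto
  have B_carrier: "B_minors n \<pi> \<subseteq> carrier ?R"
  proof
    fix f :: "'k polynomial" assume "f \<in> B_minors n \<pi>"
    then obtain p q I J where "p \<le> n" "q \<le> n" "f = det (generic_submatrix I J)" "I \<subseteq> {..<p}"
      "J \<subseteq> {..<q}" "card J = card I"
      unfolding B_iff by auto
    moreover from this have "I \<subseteq> {..<n}" "J \<subseteq> {..<n}" by auto
    ultimately show "f \<in> carrier ?R"
      using det_generic_submatrix_in_carrier[of I n J] by auto
  qed
  have ideal: "ideal (schubert_ideal n \<pi>) ?R"
    unfolding schubert_ideal_def by (rule R.genideal_ideal[OF B_carrier])
  have B_sub: "B_minors n \<pi> \<subseteq> (schubert_ideal n \<pi> :: 'k polynomial set)"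
    unfolding schubert_ideal_def by (rule R.genideal_self[OF B_carrier])

  \<comment> \<open>The cells \<open>S\<close> and the minor \<open>f\<close> on their rows and
    columns\<close>
  define v where "v = \<pi> d"
  define D where "D = {x \<in> {1..c}. \<pi> x \<le> v}"
  \<comment> \<open>The cell \<open>(c, v)\<close> lies in the diagram: \<open>\<pi> c > v\<close>
    keeps \<open>c\<close> out of \<open>D\<close>, and the dot of column \<open>v\<close> is in row
    \<open>d > c\<close>. So \<open>S\<close> has one cell in each of its rows and columns.\<close>
  define S where "S = insert (c, v) ((\<lambda>x. (x, \<pi> x)) ` D)"
  \<comment> \<open>The subtraction passes from labels counted from 1 to indices counted from 0; all
    labels are positive, so \<open>Suc\<close> undoes it.\<close>
  define I where "I = (\<lambda>x. x - 1) ` insert c D"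
  define J where "J = (\<lambda>x. x - 1) ` insert v (\<pi> ` D)"
  have range: "c \<in> {1..n}" "v \<in> {1..n}" "D \<subseteq> {1..n}" "\<pi> ` D \<subseteq> {1..n}"
  proof -
    show "c \<in> {1..n}" "v \<in> {1..n}" using abcd(1) pi_in[of d] by (auto simp: v_def)
    then show D_n: "D \<subseteq> {1..n}" by (auto simp: D_def)
    show "\<pi> ` D \<subseteq> {1..n}" using D_n pi_in by (intro image_subsetI) blast
  qed
  have c_D: "c \<notin> D" using abcd(7) by (simp add: D_def v_def)
  have v_D: "v \<notin> \<pi> ` D"
  proof
    assume "v \<in> \<pi> ` D"
    then have "d \<in> D" using inj by (simp add: v_def inj_image_mem_iff)
    then show False using abcd(4) by (simp add: D_def)
  qed
  have Suc_pred: "Suc ` (\<lambda>x. x - 1) ` A = A" if "A \<subseteq> {1..n}" for A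
  proof -
    have "Suc ` (\<lambda>x. x - 1) ` A = (\<lambda>x. x) ` A"
      unfolding image_image using that by (intro image_cong) auto
    then show ?thesis by simp
  qed
  have SucI: "Suc ` I = insert c D" and SucJ: "Suc ` J = insert v (\<pi> ` D)"
    unfolding I_def J_def by (rule Suc_pred; use range in simp)+
  have fin: "finite I" "finite J" "finite D" by (simp_all add: I_def J_def D_def)
  have fstS: "fst ` S = Suc ` I" and sndS: "snd ` S = Suc ` J"
    by (simp_all add: S_def SucI SucJ image_image)
  have I_sub: "I \<subseteq> {..<c}" using range(1) by (auto simp: I_def D_def)
  have J_sub: "J \<subseteq> {..<v}" using range(2) pi_in range(3) by (force simp: J_def D_def)
  have card_D: "card D = rank_fun \<pi> c v" by (simp add: D_def rank_fun_def)
  have card_I: "card I = 1 + rank_fun \<pi> c v"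
    using arg_cong[OF SucI, of card] c_D fin(3) card_D by (simp add: card_image)
  have card_J: "card J = card I"
    using arg_cong[OF SucJ, of card] v_D fin(3) card_D card_I inj
    by (simp add: card_image inj_on_subset)
  have I_n: "I \<subseteq> {..<n}" and J_n: "J \<subseteq> {..<n}" using I_sub J_sub range by auto

  define f where "f = (det (generic_submatrix I J) :: 'k polynomial)"
  have f_B: "f \<in> B_minors n \<pi>"
    unfolding B_iff f_def using range(1,2) I_sub J_sub card_I card_J by metis
  \<comment> \<open>The exception concerns the index sets, not \<open>(p, q)\<close>, since
    \<open>f\<close> may also arise as a minor at other cells.\<close>
  have vanish: "eval_at S (det (generic_submatrix I' J') :: 'k polynomial) = 0"
    if "I' \<subseteq> {..<p}" "J' \<subseteq> {..<q}" "card I' = 1 + rank_fun \<pi> p q" "card J' = card I'" "I' \<noteq> I \<or> J' \<noteq> J"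
    for p q I' J'
  proof (rule ccontr)
    assume nz: "eval_at S (det (generic_submatrix I' J') :: 'k polynomial) \<noteq> 0"
    have "Suc ` I' = fst ` S \<and> Suc ` J' = snd ` S"
      using eval_at_minor_neq_0D[OF that(1-4) S_def[unfolded D_def] _ nz] abcd(7) by (simp add: v_def)
    then have "I' = I \<and> J' = J"
      unfolding fstS sndS by (simp add: inj_image_eq_iff)
    with that(5) show False by blast
  qed
  have "eval_at S f \<noteq> 0"
  proof -
    \<comment> \<open>The function with graph \<open>S\<close> over the rows of \<open>S\<close>. It
      sends both \<open>c\<close> and \<open>d\<close> to \<open>v\<close>, but \<open>d\<close> is
      not a row of \<open>S\<close>, so it is injective there.\<close>
    define \<tau> where "\<tau> = \<pi>(c := v)"
    have \<tau>_D: "\<tau> x = \<pi> x" if "x \<in> D" for x using that c_D by (auto simp: \<tau>_def)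
    have \<tau>_c: "\<tau> c = v" by (simp add: \<tau>_def)
    have "bij_betw \<pi> D (\<pi> ` D)"
      by (rule inj_on_imp_bij_betw) (rule inj_on_subset[OF inj subset_UNIV])
    then have "bij_betw \<tau> D (\<pi> ` D)"
      using bij_betw_cong[of D \<tau> \<pi>] \<tau>_D by blast
    then have "bij_betw \<tau> (D \<union> {c}) (\<pi> ` D \<union> {\<tau> c})"
      using c_D v_D by (intro notIn_Un_bij_betw) (simp_all only: \<tau>_c not_False_eq_True)
    then have "bij_betw \<tau> (Suc ` I) (Suc ` J)"
      unfolding SucI SucJ \<tau>_c by simp
    then obtain w where w: "w permutes {0..<card I}" "cells I J w = (\<lambda>x. (x, \<tau> x)) ` Suc ` I"
      by (rule graph_eq_cells[OF fin(1,2)])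
    have "(\<lambda>x. (x, \<tau> x)) ` Suc ` I = S"
      unfolding SucI S_def image_insert \<tau>_c using \<tau>_D by (simp cong: image_cong)
    then show ?thesis
      using eval_at_cells_neq_0[OF fin(1,2) card_J w(1)] unfolding f_def w(2) by simp
  qed

  \<comment> \<open>The leading minor \<open>f1\<close> of \<open>f\<close> imposed at
    \<open>(a, \<pi> b)\<close>\<close>
  define k where "k = 1 + rank_fun \<pi> a (\<pi> b)"
  define I1 where "I1 = pick I ` {0..<k}"
  define J1 where "J1 = pick J ` {0..<k}"
  let ?X = "{x \<in> {1..a}. \<pi> x \<le> \<pi> b}"
  have in_n: "a \<in> {1..n}" "b \<in> {1..n}" using abcd(1) by simp_all
  have less: "a < c" "\<pi> b < \<pi> d" using abcd(2,3,5,6) by simp_all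
  have X: "?X \<subseteq> D" "a \<in> D" "b \<in> D" "a \<notin> ?X" "b \<notin> ?X" "card ?X = rank_fun \<pi> a (\<pi> b)"
    using less in_n(1,2) abcd(2,3,5,6) by (auto simp: D_def v_def rank_fun_def)
  \<comment> \<open>The rows are those of the dots in \<open>?X\<close>, and \<open>a\<close>, whose
    dot is not in \<open>?X\<close> because \<open>\<pi> a > \<pi> b\<close>. All of them lie in
    \<open>D\<close>, and row \<open>a\<close> has the index \<open>a - 1\<close>.\<close>
  have k_a: "k \<le> card {x \<in> I. x < a}"
  proof -
    have "k = card (insert a ?X)" using X by (simp add: k_def)
    also have "\<dots> \<le> card (Suc ` {x \<in> I. x < a})"
    proof (rule card_mono)
      have "x - 1 \<in> {x \<in> I. x < a}" if "x \<in> insert a ?X" for x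
        using that X(1,2) in_n(1) by (auto simp: I_def)
      moreover have "x = Suc (x - 1)" if "x \<in> insert a ?X" for x
        using that in_n(1) by auto
      ultimately show "insert a ?X \<subseteq> Suc ` {x \<in> I. x < a}" by blast
    qed (use fin in auto)
    finally show ?thesis by (simp add: card_image)
  qed
  \<comment> \<open>The columns are those of the dots in \<open>?X\<close>, and
    \<open>\<pi> b\<close>, whose dot is not in \<open>?X\<close> because
    \<open>b > a\<close>.\<close>
  have k_b: "k \<le> card {y \<in> J. y < \<pi> b}"
  proof -
    have "k = card (insert b ?X)" using X by (simp add: k_def)
    also have "\<dots> = card (\<pi> ` insert b ?X)"
      by (rule card_image[symmetric]) (rule inj_on_subset[OF inj subset_UNIV])
    also have "\<dots> \<le> card (Suc ` {y \<in> J. y < \<pi> b})"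
    proof (rule card_mono)
      have pi1: "\<pi> x \<in> {1..n}" if "x \<in> insert b ?X" for x
        using that in_n(1,2) by (intro pi_in) auto
      have "\<pi> x - 1 \<in> {y \<in> J. y < \<pi> b}" if "x \<in> insert b ?X" for x
        using that X(1,3) pi1[OF that] by (auto simp: J_def)
      moreover have "\<pi> x = Suc (\<pi> x - 1)" if "x \<in> insert b ?X" for x
        using pi1[OF that] by auto
      ultimately show "\<pi> ` insert b ?X \<subseteq> Suc ` {y \<in> J. y < \<pi> b}" by blast
    qed (use fin in auto)
    finally show ?thesis by (simp add: card_image)
  qed
  have k_I: "k \<le> card I"
    using k_a card_mono[of I "{x \<in> I. x < a}"] fin(1) by simp
  have I1: "I1 \<subseteq> {..<a}" "card I1 = k" and J1: "J1 \<subseteq> {..<\<pi> b}" "card J1 = k"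
    using pick_image_subset[OF k_a] pick_image_subset[OF k_b] card_pick_image[of k I]
      card_pick_image[of k J] k_I card_J by (simp_all add: I1_def J1_def)
  have ab_n: "a \<in> {1..n}" "\<pi> b \<in> {1..n}" using in_n(1,2) pi_in by blast+
  then have I1_n: "I1 \<subseteq> {..<n}" and J1_n: "J1 \<subseteq> {..<n}" using I1 J1 by auto
  define f1 where "f1 = (det (generic_submatrix I1 J1) :: 'k polynomial)"
  have f1_B: "f1 \<in> B_minors n \<pi>"
    unfolding B_iff f1_def using ab_n I1 J1 unfolding k_def by metis
  \<comment> \<open>Row \<open>c\<close> is used by \<open>f\<close>, while \<open>f1\<close> uses
    only rows up to \<open>a < c\<close>. So the index sets differ and \<open>f1\<close> vanishes at
    \<open>S\<close>.\<close>
  have "c - 1 \<in> I" "c - 1 \<notin> I1" using I1(1) less(1) by (auto simp: I_def)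
  then have "eval_at S f1 = 0"
    unfolding f1_def using I1 J1 by (intro vanish[of _ a _ "\<pi> b"]) (auto simp: k_def)
  \<comment> \<open>\<open>f1\<close> has a nonzero value at its own diagonal.\<close>
  have "f1 \<noteq> 0"
  proof
    assume "f1 = 0"
    have "eval_at (cells I1 J1 id) f1 \<noteq> 0"
      unfolding f1_def using I1(2) J1(2)
      by (intro eval_at_cells_neq_0 permutes_id) (simp_all add: I1_def J1_def)
    with \<open>f1 = 0\<close> show False by simp
  qed
  \<comment> \<open>The first \<open>k\<close> diagonal cells of \<open>f\<close> form the diagonal
    of \<open>f1\<close>; the quotient is the product of the remaining diagonal variables.\<close>
  have lm_f: "\<exists>t\<in>monomials n. leading_monomial r f = t + leading_monomial r f1"
  proof
    let ?E = "cells I J id" and ?E1 = "cells I1 J1 id"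
    have "?E1 \<subseteq> ?E"
      using k_I card_J I1(2) pick_image[of k I] pick_image[of k J]
      by (auto simp: cells_def I1_def J1_def)
    then have "squarefree_monomial ?E = squarefree_monomial (?E - ?E1) + squarefree_monomial ?E1"
      by (subst squarefree_monomial_Un_disjoint[symmetric]) (auto simp: Un_absorb2)
    then show "leading_monomial r f = squarefree_monomial (?E - ?E1) + leading_monomial r f1"
      using leading_monomial_det[OF ord I_n J_n card_J] leading_monomial_det[OF ord I1_n J1_n]
        I1(2) J1(2) by (simp add: f_def f1_def)
    have "?E \<subseteq> {1..n} \<times> {1..n}" by (rule cells_subset[OF permutes_id I_n J_n card_J])
    then show "squarefree_monomial (?E - ?E1) \<in> monomials n"
      by (auto simp: monomials_def keys_squarefree_monomial)
  qed

  \<comment> \<open>Reduction of \<open>f\<close> to 0\<close>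
  have "eval_at S f = 0"
  proof (rule eval_at_ideal_eq_0[OF torder ideal gb])
    show "f \<in> schubert_ideal n \<pi>" using f_B B_sub by blast
    show "homogeneous n (card I) f" unfolding f_def by (rule homogeneous_det[OF I_n J_n card_J])
    fix g assume g: "g \<in> G" "g \<noteq> 0"
    show "\<exists>g' \<in> schubert_ideal n \<pi> :: 'k polynomial set. \<exists>t\<in>monomials n. g' \<noteq> 0
      \<and> leading_monomial r g = t + leading_monomial r g' \<and> eval_at S g' = 0 \<and> (\<exists>d. homogeneous n d g')"
    proof (cases "g = f")
      \<comment> \<open>\<open>f1\<close> lies in the ideal whether or not it lies in
        \<open>G\<close>, so it can replace \<open>f\<close> as a divisor.\<close>
      case True
      have "homogeneous n (card I1) f1"
        unfolding f1_def using I1(2) J1(2) by (intro homogeneous_det[OF I1_n J1_n]) simp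
      moreover have "f1 \<in> schubert_ideal n \<pi>"
        using f1_B B_sub by (rule rev_subsetD)
      moreover obtain t where "t \<in> monomials n" "leading_monomial r f = t + leading_monomial r f1"
        using lm_f by (rule bexE)
      ultimately show ?thesis
        using \<open>f1 \<noteq> 0\<close> \<open>eval_at S f1 = 0\<close> unfolding True
        by (intro bexI[of _ f1] bexI[of _ t] conjI exI[of _ "card I1"])
    next
      \<comment> \<open>Every other element of \<open>G\<close> already vanishes at \<open>S\<close>
        and stands for itself; the quotient monomial 1 is the exponent vector
        \<open>0\<close>.\<close>
      case False
      have "g \<in> B_minors n \<pi>" using g(1) G by blast
      then obtain p q I' J' where g': "p \<in> {1..n}" "q \<in> {1..n}" "g = det (generic_submatrix I' J')"
        "I' \<subseteq> {..<p}" "J' \<subseteq> {..<q}" "card I' = 1 + rank_fun \<pi> p q" "card J' = card I'"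
        unfolding B_iff by auto
      have "I' \<noteq> I \<or> J' \<noteq> J" using False g'(3) by (auto simp: f_def)
      then have "eval_at S g = 0" unfolding g'(3) by (rule vanish[OF g'(4-7)])
      moreover have "homogeneous n (card I') g"
        unfolding g'(3) using g' by (intro homogeneous_det) auto
      moreover have "leading_monomial r g = 0 + leading_monomial r g" "0 \<in> monomials n"
        by (simp_all add: monomials_def)
      moreover have "g \<in> schubert_ideal n \<pi>"
        using \<open>g \<in> B_minors n \<pi>\<close> B_sub by (rule rev_subsetD)
      ultimately show ?thesis
        using g(2) by (intro bexI[of _ g] bexI[of _ 0] conjI exI[of _ "card I'"])
    qed
  qed
  with \<open>eval_at S f \<noteq> 0\<close> show False by contradiction
qed

lemma A_minors_subset: "A_minors n \<pi> \<subseteq> B_minors n \<pi>"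
  unfolding A_minors_def B_minors_def by (rule UN_mono) (auto simp: essential_set_def diagram_def)

theorem theorem6p1:
  fixes n :: nat and \<pi> :: "nat \<Rightarrow> nat" and r :: "monomial rel"
  assumes "\<pi> permutes {1..n}"
    and "\<not> vexillary n \<pi>"
    and "diagonal_term_order TYPE('k::field) n r"
  shows "\<not> groebner_basis n r (A_minors n \<pi> :: 'k polynomial set) (schubert_ideal n \<pi>)
    \<and> \<not> groebner_basis n r (B_minors n \<pi> :: 'k polynomial set) (schubert_ideal n \<pi>)"
proof -
  obtain a b c d where "{a, b, c, d} \<subseteq> {1..n}" "a < b" "b < c" "c < d"
    "\<pi> b < \<pi> a" "\<pi> a < \<pi> d" "\<pi> d < \<pi> c"
    using assms(2) unfolding vexillary_def by blast
  note * = not_groebner_basis[OF assms(1) this assms(3)]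
  show ?thesis
    using *[OF A_minors_subset] *[OF subset_refl] by blast
qed

end
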